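(* Let $p$ be a complex polynomial in $n$ variables of degree $2$ with $p(0)=0$. If there exists a holomorphic function $q$ on the polydisc $\mathbb{D}^n$ with $q^{(k)}(0)=0$ for all multi-indices $k$ with $|k|\le 2$ such that $\|p+q\|_{\mathbb{D}^n,\infty}\le 1$, then \[\sup_{\alpha\in\mathbb{C}^n,\ \|\alpha\|_\infty\le 1}\left\{\left|\frac{D^2p(0)\cdot A_\alpha}{2}\right|+\left|Dp(0)\cdot\alpha\right|^2\right\}\le 1.\]
   Context: For $\alpha=(\alpha_1,\ldots,\alpha_n)\in\mathbb{C}^n$: $\|\alpha\|_\infty=\max_i|\alpha_i|$, $A_\alpha$ is the matrix $(\alpha_i\alpha_j)_{i,j}$, $D^2p(0)\cdot A_\alpha=\sum_{i,j=1}^n\frac{\partial^2p}{\partial z_i\partial z_j}(0)\alpha_i\alpha_j$, and $Dp(0)\cdot\alpha=\sum_{i=1}^n\frac{\partial p}{\partial z_i}(0)\alpha_i$. $\mathbb{D}$ is the open unit disc; $\|f\|_{\mathbb{D}^n,\infty}=\sup_{z\in\mathbb{D}^n}|f(z)|$; $q^{(k)}$ is the partial derivative of $q$ of multi-index $k$. *)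

theory Defs
  imports "HOL-Complex_Analysis.Complex_Analysis" "HOL-Library.Poly_Mapping"
begin

type_synonym 'n multi_index = "'n \<Rightarrow> nat"

definition mi_size :: "'n::finite multi_index \<Rightarrow> nat" where
  "mi_size k = (\<Sum>i\<in>UNIV. k i)"

text \<open>A polynomial in the variables indexed by \<open>'n\<close> is its finitely supported family of
  coefficients; the monomials are the multi-indices.\<close>

type_synonym 'n cpoly = "'n multi_index \<Rightarrow>\<^sub>0 complex"

text \<open>The \<open>insert 0\<close> gives the zero polynomial degree 0.\<close>

definition total_degree :: "'n::finite cpoly \<Rightarrow> nat" where
  "total_degree p = Max (insert 0 (mi_size ` Poly_Mapping.keys p))"

definition poly_eval :: "'n::finite cpoly \<Rightarrow> complex ^ 'n \<Rightarrow> complex" where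
  "poly_eval p z = (\<Sum>k\<in>Poly_Mapping.keys p. Poly_Mapping.lookup p k * (\<Prod>i\<in>UNIV. (z $ i) ^ k i))"

definition max_norm :: "complex ^ 'n::finite \<Rightarrow> real" where
  "max_norm \<alpha> = Max (range (\<lambda>i. cmod (\<alpha> $ i)))"

definition polydisc :: "(complex ^ 'n::finite) set" where
  "polydisc = {z. \<forall>i. z $ i \<in> ball 0 1}"

text \<open>The supremum is taken in the extended reals, so that it is infinite (rather than an
  unspecified real) for an unbounded function.\<close>

definition sup_norm_on :: "'a set \<Rightarrow> ('a \<Rightarrow> complex) \<Rightarrow> ereal" where
  "sup_norm_on S f = (SUP z\<in>S. ereal (cmod (f z)))"

text \<open>Holomorphy in several variables on an open set: at every point there is a (real) Frechet
  derivative, and it is complex-linear. Since \<open>S\<close> is meant to be open, values of \<open>f\<close>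
  outside \<open>S\<close> play no role.\<close>

definition holomorphic_several :: "(complex ^ 'n::finite \<Rightarrow> complex) \<Rightarrow> (complex ^ 'n) set \<Rightarrow> bool"
  where "holomorphic_several f S \<longleftrightarrow>
    (\<forall>z\<in>S. \<exists>f'. (f has_derivative f') (at z) \<and> (\<forall>c v. f' (c *s v) = c * f' v))"

definition partial :: "'n::finite \<Rightarrow> (complex ^ 'n \<Rightarrow> complex) \<Rightarrow> complex ^ 'n \<Rightarrow> complex" where
  "partial i f z = deriv (\<lambda>w. f (\<chi> j. if j = i then w else z $ j)) (z $ i)"

text \<open>A fixed numbering of the coordinates, used only to fix the order in which the partial
  derivatives of a multi-index derivative are taken; for holomorphic functions the order is
  immaterial.\<close>

definition coord_list :: "'n::finite list" where
  "coord_list = (SOME xs. distinct xs \<and> set xs = UNIV)"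

definition multi_deriv ::
  "'n::finite multi_index \<Rightarrow> (complex ^ 'n \<Rightarrow> complex) \<Rightarrow> complex ^ 'n \<Rightarrow> complex" where
  "multi_deriv k f = foldr (\<lambda>i. partial i ^^ k i) coord_list f"

definition D1 :: "(complex ^ 'n::finite \<Rightarrow> complex) \<Rightarrow> complex ^ 'n \<Rightarrow> complex ^ 'n \<Rightarrow> complex" where
  "D1 f z \<alpha> = (\<Sum>i\<in>UNIV. partial i f z * \<alpha> $ i)"

definition outer :: "complex ^ 'n::finite \<Rightarrow> complex ^ 'n ^ 'n" where
  "outer \<alpha> = (\<chi> i j. \<alpha> $ i * \<alpha> $ j)"

definition D2 ::
  "(complex ^ 'n::finite \<Rightarrow> complex) \<Rightarrow> complex ^ 'n \<Rightarrow> complex ^ 'n ^ 'n \<Rightarrow> complex" where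
  "D2 f z A = (\<Sum>i\<in>UNIV. \<Sum>j\<in>UNIV. partial i (partial j f) z * A $ i $ j)"

end

theory Submission
  imports Defs
begin

text \<open>
  Fix \<open>\<alpha>\<close> in the closed unit polydisc and restrict \<open>p + q\<close> to the complex line through \<open>\<alpha>\<close>:
  the function \<open>f s = p (s \<alpha>) + q (s \<alpha>)\<close> is holomorphic on the unit disc, bounded by \<open>1\<close> and vanishes
  at \<open>0\<close>. Writing \<open>f s = a s + b s\<^sup>2 + \<dots>\<close>, the function \<open>f s / s\<close> is still bounded by \<open>1\<close> by the
  Schwarz lemma, and the Schwarz--Pick inequality for it at the origin reads \<open>\<bar>b\<bar> \<le> 1 - \<bar>a\<bar>\<^sup>2\<close>
  (\<open>schwarz_second_coefficient\<close>). Since \<open>q\<close> has no terms of order less than three,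
  \<open>a = Dp(0) \<alpha>\<close> and \<open>b = D\<^sup>2p(0) A\<^sub>\<alpha> / 2\<close>, which is the claim.

  The remaining work is the identification of the coefficients, that is, the second-order chain
  rule along a line for a function that is only known to be complex Frechet differentiable at each
  point (\<open>D2_outer_eq_second_dir_deriv\<close>). The derivative along a line in direction \<open>u\<close> of the
  directional derivative in direction \<open>v\<close> is linear in \<open>v\<close>. Once it is known to be symmetric in
  \<open>u\<close> and \<open>v\<close> it is bilinear, hence determined by the iterated partial derivatives. Symmetry is a
  statement about the restriction to a complex plane, a bounded function of two variables that is
  holomorphic in each (\<open>mixed_partials_commute\<close>): its difference quotients in one variable converge
  uniformly in the other one, so their derivatives converge as well, and the two orders of
  differentiation compute the same limit. Symmetry also makes the vanishing of the
  multi-index derivatives of \<open>q\<close> independent of the order in which they are taken.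
\<close>

section \<open>A coefficient inequality for bounded functions on the disc\<close>

lemma norm_of_real_mult_less_1:
  assumes "0 < r" "r < 1" "cmod w \<le> 1"
  shows "cmod (of_real r * w) < 1"
proof -
  have "r * cmod w \<le> r * 1" using assms by (intro mult_left_mono) auto
  then have "r * cmod w < 1" using assms(2) by linarith
  then show ?thesis using assms(1) by (simp add: norm_mult)
qed

text \<open>Composing with the Moebius automorphism of the disc that moves the value
  \<open>g 0\<close> to \<open>0\<close> makes the Schwarz lemma applicable; at \<open>g 0\<close> that automorphism has derivative
  \<open>1 / (1 - \<bar>g 0\<bar>\<^sup>2)\<close>, and this factor is what the bound records.\<close>

lemma schwarz_pick_at_zero:
  assumes holg: "g holomorphic_on ball 0 1"
    and lt1: "\<And>z. norm z < 1 \<Longrightarrow> norm (g z) < 1"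
  shows "cmod (deriv g 0) \<le> 1 - (cmod (g 0))\<^sup>2"
proof -
  define a where "a = g 0"
  have a1: "cmod a < 1" unfolding a_def by (rule lt1) simp
  have sq: "(cmod a)\<^sup>2 < 1" using a1 by (simp add: abs_square_less_1)
  have ca: "1 - cnj a * a = of_real (1 - (cmod a)\<^sup>2)"
    by (metis complex_norm_square mult.commute of_real_1 of_real_diff)
  have ne: "1 - cnj a * a \<noteq> 0" using sq unfolding ca of_real_eq_0_iff by simp
  let ?F = "\<lambda>z. Moebius_function 0 a (g z)"
  have dphi: "(Moebius_function 0 a has_field_derivative 1 / (1 - cnj a * a)) (at a)"
    unfolding Moebius_function_simple[abs_def]
    by (rule derivative_eq_intros refl ne | simp add: ne)+
  have dg: "(g has_field_derivative deriv g 0) (at 0)"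
    by (rule holomorphic_derivI[OF holg]) auto
  have "(?F has_field_derivative 1 / (1 - cnj a * a) * deriv g 0) (at 0)"
    using DERIV_chain2[OF dphi[unfolded a_def] dg] by (simp add: a_def)
  then have dF: "deriv ?F 0 = deriv g 0 / (1 - cnj a * a)"
    by (simp add: DERIV_imp_deriv)
  have "?F holomorphic_on ball 0 1"
    using holomorphic_on_compose_gen[OF holg Moebius_function_holomorphic[OF a1, of 0]] lt1
    by (simp add: o_def image_subset_iff)
  then have "cmod (deriv ?F 0) \<le> 1"
    by (rule Schwarz_Lemma(2)[where \<xi> = 0])
       (auto simp: a_def[symmetric] Moebius_function_eq_zero intro: Moebius_function_norm_lt_1 lt1 a1)
  then have "cmod (deriv g 0) / (1 - (cmod a)\<^sup>2) \<le> 1"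
    using sq unfolding dF ca norm_divide norm_of_real by simp
  then show ?thesis using sq by (simp add: a_def divide_le_eq)
qed

text \<open>The closed bound allows unimodular constants, for which there is no automorphism to compose
  with. Shrinking by a factor \<open>r < 1\<close> restores the strict bound, and \<open>r\<close> tends to \<open>1\<close>.\<close>

lemma schwarz_pick_at_zero_closed_disc:
  assumes holg: "g holomorphic_on ball 0 1"
    and le1: "\<And>z. norm z < 1 \<Longrightarrow> norm (g z) \<le> 1"
  shows "cmod (deriv g 0) \<le> 1 - (cmod (g 0))\<^sup>2"
proof -
  have ev: "r * cmod (deriv g 0) \<le> 1 - (r * cmod (g 0))\<^sup>2" if r: "0 < r" "r < 1" for r :: real
  proof -
    have "cmod (of_real r * g z) < 1" if "norm z < 1" for z
      by (intro norm_of_real_mult_less_1 r le1 that)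
    moreover have "(\<lambda>z. of_real r * g z) holomorphic_on ball 0 1"
      by (intro holomorphic_intros holg)
    ultimately have "cmod (deriv (\<lambda>z. of_real r * g z) 0) \<le> 1 - (cmod (of_real r * g 0))\<^sup>2"
      by (intro schwarz_pick_at_zero) auto
    moreover have "deriv (\<lambda>z. of_real r * g z) 0 = of_real r * deriv g 0"
      by (intro DERIV_imp_deriv DERIV_cmult holomorphic_derivI[OF holg]) auto
    ultimately show ?thesis using r by (simp add: norm_mult)
  qed
  have "((\<lambda>r. r * cmod (deriv g 0)) \<longlongrightarrow> 1 * cmod (deriv g 0)) (at_left (1::real))"
       "((\<lambda>r. 1 - (r * cmod (g 0))\<^sup>2) \<longlongrightarrow> 1 - (1 * cmod (g 0))\<^sup>2) (at_left (1::real))"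
    by (intro tendsto_intros)+
  moreover have "eventually (\<lambda>r. r * cmod (deriv g 0) \<le> 1 - (r * cmod (g 0))\<^sup>2) (at_left (1::real))"
    by (rule eventually_at_leftI[of 0]) (use ev in auto)
  ultimately show ?thesis
    using tendsto_le[of "at_left (1::real)"] by simp
qed

text \<open>The Schwarz lemma lets one divide by the variable: \<open>f z = z * h z\<close> with \<open>h\<close> again bounded by
  \<open>1\<close>. The first two Taylor coefficients of \<open>h\<close> are the coefficients of \<open>f\<close> of order one and two,
  so the inequality is the Schwarz--Pick inequality for \<open>h\<close> at the origin.\<close>

lemma schwarz_second_coefficient:
  assumes holf: "f holomorphic_on ball 0 1" and f0: "f 0 = 0"
    and le1: "\<And>z. norm z < 1 \<Longrightarrow> norm (f z) \<le> 1"
  shows "cmod (deriv (deriv f) 0 / 2) + (cmod (deriv f 0))\<^sup>2 \<le> 1"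
proof -
  obtain h where holh: "h holomorphic_on ball 0 1"
    and fh: "\<And>z. norm z < 1 \<Longrightarrow> f z = z * h z" and h0: "deriv f 0 = h 0"
    using Schwarz3[OF holf f0] by blast
  \<comment> \<open>The Schwarz lemma needs values in the open disc, so it is applied to \<open>r * f\<close>.\<close>
  have scaled: "r * cmod (f z) \<le> cmod z" "r * cmod (h 0) \<le> 1"
    if r: "0 < r" "r < 1" and z: "norm z < 1" for r :: real and z
  proof -
    let ?g = "\<lambda>z. of_real r * f z"
    have g: "?g holomorphic_on ball 0 1" by (intro holomorphic_intros holf)
    have lt: "cmod (?g w) < 1" if "norm w < 1" for w
      by (intro norm_of_real_mult_less_1 r le1 that)
    have d: "deriv ?g 0 = of_real r * h 0"
      unfolding h0[symmetric] by (intro DERIV_imp_deriv DERIV_cmult holomorphic_derivI[OF holf]) auto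
    show "r * cmod (f z) \<le> cmod z"
      using Schwarz_Lemma(1)[OF g _ lt z] r f0 by (simp add: norm_mult)
    show "r * cmod (h 0) \<le> 1"
      using Schwarz_Lemma(2)[OF g _ lt z] r f0 by (simp add: norm_mult d)
  qed
  have h1: "cmod (h z) \<le> 1" if z: "norm z < 1" for z
  proof (cases "z = 0")
    case True
    show ?thesis unfolding True
      by (rule field_le_mult_one_interval) (use scaled(2)[of _ 0] in auto)
  next
    case False
    have "cmod (f z) \<le> cmod z"
      by (rule field_le_mult_one_interval) (use scaled(1) z in auto)
    then show ?thesis using False by (simp add: fh[OF z] norm_mult)
  qed
  have df: "deriv f z = h z + z * deriv h z" if "z \<in> ball 0 1" for z
  proof (rule DERIV_imp_deriv, rule has_field_derivative_transform_within_open[where S = "ball 0 1"])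
    show "((\<lambda>z. z * h z) has_field_derivative h z + z * deriv h z) (at z)"
      by (auto intro!: derivative_eq_intros holomorphic_derivI[OF holh] that)
  qed (use that fh in auto)
  have holh': "deriv h holomorphic_on ball 0 1"
    by (intro holomorphic_deriv holh open_ball)
  have "deriv (deriv f) 0 = 2 * deriv h 0"
  proof (rule DERIV_imp_deriv, rule has_field_derivative_transform_within_open[where S = "ball 0 1"])
    show "((\<lambda>z. h z + z * deriv h z) has_field_derivative 2 * deriv h 0) (at 0)"
      by (rule derivative_eq_intros holomorphic_derivI[OF holh] holomorphic_derivI[OF holh'] refl | simp)+
  qed (use df in auto)
  then show ?thesis
    using schwarz_pick_at_zero_closed_disc[OF holh h1] by (simp add: h0)
qed

section \<open>Mixed partial derivatives of separately holomorphic functions\<close>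

text \<open>Taylor's formula of first order. The second derivative on \<open>cball 0 (r / 4)\<close> is controlled by
  Cauchy's inequality on circles of radius \<open>r / 4\<close>, which stay inside \<open>ball 0 r\<close>; this gives the
  constant \<open>2! * M / (r / 4)\<^sup>2\<close>. It depends on \<open>f\<close> only through \<open>M\<close>, so the estimate is uniform
  over a bounded family of functions.\<close>

lemma difference_quotient_bound:
  assumes hol: "f holomorphic_on ball 0 r" and r: "0 < r"
    and bd: "\<And>z. z \<in> ball 0 r \<Longrightarrow> cmod (f z) \<le> M"
    and t: "cmod t \<le> r / 4" "t \<noteq> 0"
  shows "cmod ((f t - f 0) / t - deriv f 0) \<le> (32 * M / r\<^sup>2) * cmod t"
proof -
  have second: "cmod (deriv (deriv f) x) \<le> 32 * M / r\<^sup>2" if x: "x \<in> cball 0 (r/4)" for x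
  proof -
    have sub: "cball x (r/4) \<subseteq> ball 0 r"
    proof
      fix y assume "y \<in> cball x (r/4)"
      then have "cmod (y - x) \<le> r/4" by (simp add: dist_norm norm_minus_commute)
      moreover have "cmod x \<le> r/4" using x by simp
      ultimately show "y \<in> ball 0 r" using norm_triangle_ineq[of x "y - x"] r by auto
    qed
    have "cmod ((deriv ^^ 2) f x) \<le> fact 2 * M / (r/4)^2"
    proof (rule Cauchy_inequality)
      show "f holomorphic_on ball x (r/4)"
        using hol sub by (meson ball_subset_cball holomorphic_on_subset)
      show "continuous_on (cball x (r/4)) f"
        using hol sub by (meson holomorphic_on_imp_continuous_on continuous_on_subset)
      show "cmod (f y) \<le> M" if "cmod (x - y) = r/4" for y
        using bd[of y] sub that by (auto simp: dist_norm)
    qed (use r in auto)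
    then show ?thesis by (simp add: power2_eq_square field_simps numeral_2_eq_2)
  qed
  have "cmod (((\<lambda>i. (deriv ^^ i) f) 0 t) - (\<Sum>i\<le>1. (\<lambda>i. (deriv ^^ i) f) i 0 * (t - 0)^i / fact i))
        \<le> (32 * M / r\<^sup>2) * cmod (t - 0)^Suc 1 / fact 1"
  proof (rule complex_Taylor[of "cball 0 (r/4)" 1 "\<lambda>i. (deriv ^^ i) f"])
    show "((deriv ^^ i) f has_field_derivative (deriv ^^ Suc i) f x) (at x within cball 0 (r/4))"
      if "x \<in> cball 0 (r/4)" for i x
    proof -
      have "x \<in> ball 0 r" using that r by auto
      then have "((deriv ^^ i) f has_field_derivative deriv ((deriv ^^ i) f) x) (at x)"
        using holomorphic_derivI[OF holomorphic_higher_deriv[OF hol open_ball] open_ball] by blast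
      then show ?thesis by (simp add: has_field_derivative_at_within)
    qed
  qed (use second t r in auto)
  then have "cmod (f t - f 0 - deriv f 0 * t) \<le> (32 * M / r\<^sup>2) * (cmod t * cmod t)"
    by (simp add: power2_eq_square algebra_simps)
  moreover have "(f t - f 0) / t - deriv f 0 = (f t - f 0 - deriv f 0 * t) / t"
    using t by (simp add: field_simps)
  ultimately show ?thesis using t by (simp add: norm_divide divide_le_eq mult.assoc)
qed

text \<open>The difference quotients of \<open>G\<close> in the second variable are holomorphic in the first one, and
  they converge uniformly to the partial derivative. By Weierstrass' theorem the limit is
  holomorphic and its derivative \<open>L\<close> is the limit of the derivatives of the quotients. The second
  conjunct therefore expresses \<open>L\<close> as a limit of difference quotients taken in the other order.\<close>

lemma derivative_of_partial_derivative:
  assumes r: "0 < r"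
    and hol1: "\<And>t. t \<in> ball 0 r \<Longrightarrow> (\<lambda>s. G s t) holomorphic_on ball 0 r"
    and hol2: "\<And>s. s \<in> ball 0 r \<Longrightarrow> G s holomorphic_on ball 0 r"
    and bd: "\<And>s t. s \<in> ball 0 r \<Longrightarrow> t \<in> ball 0 r \<Longrightarrow> cmod (G s t) \<le> M"
  shows "\<exists>L. ((\<lambda>s. deriv (G s) 0) has_field_derivative L) (at 0) \<and>
             ((\<lambda>t. (deriv (\<lambda>s. G s t) 0 - deriv (\<lambda>s. G s 0) 0) / t) \<longlongrightarrow> L) (at 0)"
proof -
  let ?g = "\<lambda>t s. (G s t - G s 0) / t"
  let ?g' = "\<lambda>t s. (deriv (\<lambda>s. G s t) s - deriv (\<lambda>s. G s 0) s) / t"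
  have ev: "eventually (\<lambda>t. t \<noteq> 0 \<and> cmod t \<le> r/4) (at 0)"
    unfolding eventually_at by (rule exI[of _ "r/4"]) (use r in auto)
  have cont: "eventually (\<lambda>t. continuous_on (cball 0 (r/2)) (?g t) \<and>
      (\<forall>w\<in>ball 0 (r/2). (?g t has_field_derivative ?g' t w) (at w))) (at 0)"
    using ev
  proof eventually_elim
    case (elim t)
    then have t: "t \<in> ball 0 r" "t \<noteq> 0" and z: "0 \<in> ball (0::complex) r" using r by auto
    have sub: "cball (0::complex) (r/2) \<subseteq> ball 0 r" using r by auto
    have "?g t holomorphic_on ball 0 r"
      using t by (intro holomorphic_intros hol1[OF t(1)] hol1[OF z])
    then have "continuous_on (cball 0 (r/2)) (?g t)"
      using sub by (meson holomorphic_on_imp_continuous_on continuous_on_subset)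
    moreover have "(?g t has_field_derivative ?g' t w) (at w)" if "w \<in> ball 0 (r/2)" for w
    proof -
      have w: "w \<in> ball 0 r" using that r by auto
      show ?thesis
        by (intro DERIV_cdivide DERIV_diff holomorphic_derivI[OF hol1[OF t(1)] open_ball w]
            holomorphic_derivI[OF hol1[OF z] open_ball w])
    qed
    ultimately show ?case by blast
  qed
  have lim: "uniform_limit (cball 0 (r/2)) ?g (\<lambda>s. deriv (G s) 0) (at 0)"
  proof (rule uniform_limitI)
    fix e :: real assume e: "0 < e"
    have "((\<lambda>t. (32 * M / r\<^sup>2) * cmod t) \<longlongrightarrow> (32 * M / r\<^sup>2) * cmod 0) (at (0::complex))"
      by (intro tendsto_intros)
    then have "eventually (\<lambda>t. (32 * M / r\<^sup>2) * cmod t < e) (at (0::complex))"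
      using e by (intro order_tendstoD) auto
    then show "\<forall>\<^sub>F t in at 0. \<forall>s\<in>cball 0 (r/2). dist (?g t s) (deriv (G s) 0) < e"
      using ev
    proof eventually_elim
      case (elim t)
      show ?case
      proof
        fix s :: complex assume "s \<in> cball 0 (r/2)"
        then have s: "s \<in> ball 0 r" using r by auto
        show "dist (?g t s) (deriv (G s) 0) < e"
          using difference_quotient_bound[OF hol2[OF s] r bd[OF s], of t] elim
          by (simp add: dist_norm)
      qed
    qed
  qed
  obtain g' where "\<And>w. w \<in> ball 0 (r/2) \<Longrightarrow> ((\<lambda>s. deriv (G s) 0) has_field_derivative g' w) (at w)
        \<and> ((\<lambda>t. ?g' t w) \<longlongrightarrow> g' w) (at 0)"
    using has_complex_derivative_uniform_limit[OF cont lim] r by auto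
  then show ?thesis using r by (intro exI[of _ "g' 0"]) auto
qed

text \<open>The classical theorem on mixed partial derivatives asks for continuous second derivatives; here
  their role is taken by the uniform bound on \<open>G\<close>, through Cauchy's inequality. The limit \<open>L\<close> of the
  previous lemma is the derivative in one order by its first conjunct and in the other by its second.\<close>

lemma mixed_partials_commute:
  assumes r: "0 < r"
    and hol1: "\<And>t. t \<in> ball 0 r \<Longrightarrow> (\<lambda>s. G s t) holomorphic_on ball 0 r"
    and hol2: "\<And>s. s \<in> ball 0 r \<Longrightarrow> G s holomorphic_on ball 0 r"
    and bd: "\<And>s t. s \<in> ball 0 r \<Longrightarrow> t \<in> ball 0 r \<Longrightarrow> cmod (G s t) \<le> M"
  shows "(\<lambda>s. deriv (G s) 0) field_differentiable at 0"
    and "deriv (\<lambda>s. deriv (G s) 0) 0 = deriv (\<lambda>t. deriv (\<lambda>s. G s t) 0) 0"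
proof -
  obtain L where L: "((\<lambda>s. deriv (G s) 0) has_field_derivative L) (at 0)"
     "((\<lambda>t. (deriv (\<lambda>s. G s t) 0 - deriv (\<lambda>s. G s 0) 0) / t) \<longlongrightarrow> L) (at 0)"
    using derivative_of_partial_derivative[of r G M] assms by blast
  show "(\<lambda>s. deriv (G s) 0) field_differentiable at 0"
    using L(1) field_differentiable_def by blast
  have "((\<lambda>t. deriv (\<lambda>s. G s t) 0) has_field_derivative L) (at 0)"
    using L(2) by (simp add: has_field_derivative_iff)
  then show "deriv (\<lambda>s. deriv (G s) 0) 0 = deriv (\<lambda>t. deriv (\<lambda>s. G s t) 0) 0"
    using L(1) by (simp add: DERIV_imp_deriv)
qed

section \<open>Second directional derivatives in several variables\<close>

definition dir_deriv :: "(complex ^ 'n::finite \<Rightarrow> complex) \<Rightarrow> complex ^ 'n \<Rightarrow> complex ^ 'n \<Rightarrow> complex"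
  where "dir_deriv f v z = frechet_derivative f (at z) v"

definition second_dir_deriv ::
  "(complex ^ 'n::finite \<Rightarrow> complex) \<Rightarrow> complex ^ 'n \<Rightarrow> complex ^ 'n \<Rightarrow> complex"
  where "second_dir_deriv f u v = deriv (\<lambda>s. dir_deriv f v (s *s u)) 0"

lemma norm_vector_scalar_mult: "norm (c *s v) = cmod c * norm (v :: complex ^ 'n::finite)"
  by (simp add: norm_vec_def norm_mult L2_set_right_distrib)

lemma bounded_linear_scalar_mult_left: "bounded_linear (\<lambda>c. c *s (v :: complex ^ 'n::finite))"
  by (rule bounded_linear_intro[where K = "norm v"])
     (simp_all add: vec_eq_iff algebra_simps norm_vector_scalar_mult)

lemma zero_in_polydisc: "0 \<in> polydisc"
  by (simp add: polydisc_def)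

lemma ball_subset_polydisc: "ball 0 1 \<subseteq> (polydisc :: (complex ^ 'n::finite) set)"
proof
  fix z :: "complex ^ 'n"
  assume "z \<in> ball 0 1"
  then have "cmod (z $ i) < 1" for i using Finite_Cartesian_Product.norm_nth_le[of z i] by simp
  then show "z \<in> polydisc" by (simp add: polydisc_def)
qed

lemma scaled_in_polydisc:
  assumes "max_norm \<alpha> \<le> 1" "cmod s < 1"
  shows "s *s \<alpha> \<in> polydisc"
proof -
  have "cmod (s * \<alpha> $ i) < 1" for i
  proof -
    have "cmod (\<alpha> $ i) \<le> 1"
      using assms(1) Max_ge[of "range (\<lambda>i. cmod (\<alpha> $ i))" "cmod (\<alpha> $ i)"]
      unfolding max_norm_def by force
    then have "cmod s * cmod (\<alpha> $ i) \<le> cmod s * 1" by (intro mult_left_mono) auto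
    then show ?thesis using assms(2) unfolding norm_mult by linarith
  qed
  then show ?thesis by (simp add: polydisc_def)
qed

lemma
  assumes "holomorphic_several f S" "z \<in> S"
  shows has_derivative_dir_deriv: "(f has_derivative (\<lambda>v. dir_deriv f v z)) (at z)"
    and dir_deriv_scale: "dir_deriv f (c *s v) z = c * dir_deriv f v z"
proof -
  obtain f' where f': "(f has_derivative f') (at z)" "\<forall>c v. f' (c *s v) = c * f' v"
    using assms unfolding holomorphic_several_def by blast
  have "f' = (\<lambda>v. dir_deriv f v z)"
    using frechet_derivative_at[OF f'(1)] by (simp add: dir_deriv_def)
  then show "(f has_derivative (\<lambda>v. dir_deriv f v z)) (at z)"
      "dir_deriv f (c *s v) z = c * dir_deriv f v z"
    using f' by auto
qed

lemma linear_dir_deriv: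
  assumes "holomorphic_several f S" "z \<in> S"
  shows "linear (\<lambda>v. dir_deriv f v z)"
  using has_derivative_dir_deriv[OF assms] by (rule has_derivative_linear)

lemma dir_deriv_expand:
  assumes "holomorphic_several f S" "z \<in> S"
  shows "dir_deriv f \<alpha> z = (\<Sum>i\<in>UNIV. \<alpha> $ i * dir_deriv f (axis i 1) z)"
proof -
  have "dir_deriv f \<alpha> z = dir_deriv f (\<Sum>i\<in>UNIV. \<alpha> $ i *s axis i 1) z"
    by (simp only: basis_expansion)
  also have "\<dots> = (\<Sum>i\<in>UNIV. dir_deriv f (\<alpha> $ i *s axis i 1) z)"
    by (rule linear_sum[OF linear_dir_deriv[OF assms]])
  also have "\<dots> = (\<Sum>i\<in>UNIV. \<alpha> $ i * dir_deriv f (axis i 1) z)"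
    by (simp only: dir_deriv_scale[OF assms])
  finally show ?thesis .
qed

lemma has_field_derivative_along_line:
  assumes "holomorphic_several f S" "a + s *s v \<in> S"
  shows "((\<lambda>s. f (a + s *s v)) has_field_derivative dir_deriv f v (a + s *s v)) (at s)"
proof -
  have "((\<lambda>s. a + s *s v) has_derivative (\<lambda>h. h *s v)) (at s)"
    using has_derivative_add[OF has_derivative_const
        bounded_linear_imp_has_derivative[OF bounded_linear_scalar_mult_left[of v]], of a "at s"] by simp
  from has_derivative_compose[OF this has_derivative_dir_deriv[OF assms]]
  have "((\<lambda>s. f (a + s *s v)) has_derivative (\<lambda>h. dir_deriv f (h *s v) (a + s *s v))) (at s)" .
  then show ?thesis
    unfolding dir_deriv_scale[OF assms] has_field_derivative_def
    by (simp only: mult_commute_abs)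
qed

lemma partial_eq_dir_deriv:
  assumes "holomorphic_several f S" "z \<in> S"
  shows "partial i f z = dir_deriv f (axis i 1) z"
proof -
  have "(\<lambda>w. f (\<chi> j. if j = i then w else z $ j))
      = (\<lambda>w. f ((\<chi> j. if j = i then 0 else z $ j) + w *s axis i 1))"
    by (intro ext arg_cong[where f = f]) (simp add: vec_eq_iff axis_def)
  moreover have "(\<chi> j. if j = i then 0 else z $ j) + z $ i *s axis i 1 = z"
    by (simp add: vec_eq_iff axis_def)
  ultimately show ?thesis
    using has_field_derivative_along_line[OF assms(1), of "\<chi> j. if j = i then 0 else z $ j" "z $ i" "axis i 1"] assms(2)
    by (simp add: partial_def DERIV_imp_deriv)
qed

text \<open>Restricting \<open>f\<close> to the complex plane spanned by \<open>u\<close> and \<open>v\<close> gives a function of two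
  complex variables, to which the exchange of mixed partial derivatives applies; it is bounded near the
  origin because \<open>f\<close> is continuous there. Symmetry is what makes the second derivative
  bilinear: linearity in \<open>v\<close> is inherited from the first derivative, and symmetry transfers it to \<open>u\<close>.\<close>

lemma
  assumes f: "holomorphic_several f (polydisc :: (complex ^ 'n::finite) set)"
  shows dir_deriv_differentiable_along_line:
      "(\<lambda>s. dir_deriv f v (s *s u)) field_differentiable at 0"
    and second_dir_deriv_commute: "second_dir_deriv f u v = second_dir_deriv f v u"
proof -
  have "isCont f 0"
    using has_derivative_dir_deriv[OF f zero_in_polydisc] has_derivative_continuous by blast
  then obtain d where d: "d > 0" "\<And>z. dist z 0 < d \<Longrightarrow> dist (f z) (f 0) < 1"
    unfolding continuous_at_eps_delta by (meson zero_less_one)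
  \<comment> \<open>Below \<open>d\<close> the function is bounded, below \<open>1\<close> the point lies in the polydisc.\<close>
  define e where "e = min d 1"
  \<comment> \<open>For \<open>s\<close> and \<open>t\<close> of modulus less than \<open>r\<close> the norm of \<open>s *s u + t *s v\<close> stays below \<open>e\<close>; the
    summand \<open>1\<close> covers \<open>u = v = 0\<close>.\<close>
  define r where "r = e / (norm u + norm v + 1)"
  have e: "e > 0" "e \<le> d" "e \<le> 1" using d by (auto simp: e_def)
  have pos: "norm u + norm v + 1 > 0" by (intro add_nonneg_pos add_nonneg_nonneg) auto
  have r: "0 < r" using e pos by (simp add: r_def)
  have small: "norm (s *s u + t *s v) < e" if "s \<in> ball 0 r" "t \<in> ball 0 r" for s t
  proof -
    have "norm (s *s u + t *s v) \<le> cmod s * norm u + cmod t * norm v"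
      by (metis norm_triangle_ineq norm_vector_scalar_mult)
    also have "\<dots> \<le> r * norm u + r * norm v"
      using that by (intro add_mono mult_right_mono) auto
    also have "\<dots> < r * (norm u + norm v + 1)" using r by (simp add: algebra_simps)
    also have "\<dots> = e" using pos by (simp add: r_def)
    finally show ?thesis .
  qed
  have inP: "s *s u + t *s v \<in> polydisc" if "s \<in> ball 0 r" "t \<in> ball 0 r" for s t
    using small[OF that] e(3) by (intro subsetD[OF ball_subset_polydisc]) simp
  let ?G = "\<lambda>s t. f (s *s u + t *s v)"
  have dt: "((\<lambda>t. ?G s t) has_field_derivative dir_deriv f v (s *s u + t *s v)) (at t)"
    if "s \<in> ball 0 r" "t \<in> ball 0 r" for s t
    by (rule has_field_derivative_along_line[OF f inP[OF that]])
  have ds: "((\<lambda>s. ?G s t) has_field_derivative dir_deriv f u (s *s u + t *s v)) (at s)"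
    if "s \<in> ball 0 r" "t \<in> ball 0 r" for s t
    using has_field_derivative_along_line[OF f, of "t *s v" s u] inP[OF that] by (simp add: add.commute)
  have z: "(0::complex) \<in> ball 0 r" using r by simp
  have bd: "cmod (?G s t) \<le> cmod (f 0) + 1" if "s \<in> ball 0 r" "t \<in> ball 0 r" for s t
  proof -
    have "dist (?G s t) (f 0) < 1" using small[OF that] e by (intro d) simp
    then show ?thesis using norm_triangle_ineq2[of "?G s t" "f 0"] by (simp add: dist_norm)
  qed
  have hol1: "(\<lambda>s. ?G s t) holomorphic_on ball 0 r" if "t \<in> ball 0 r" for t
    using ds[OF _ that] unfolding holomorphic_on_open[OF open_ball] by blast
  have hol2: "?G s holomorphic_on ball 0 r" if "s \<in> ball 0 r" for s
    using dt[OF that] unfolding holomorphic_on_open[OF open_ball] by blast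
  have evr: "eventually (\<lambda>s. s \<in> ball 0 r) (nhds (0::complex))"
    by (rule eventually_nhds_in_open) (use r in auto)
  have ev1: "eventually (\<lambda>s. deriv (?G s) 0 = dir_deriv f v (s *s u)) (nhds 0)"
    using evr by eventually_elim (use DERIV_imp_deriv[OF dt[OF _ z]] in simp)
  have ev2: "eventually (\<lambda>t. deriv (\<lambda>s. ?G s t) 0 = dir_deriv f u (t *s v)) (nhds 0)"
    using evr by eventually_elim (use DERIV_imp_deriv[OF ds[OF z]] in simp)
  have "(\<lambda>s. deriv (?G s) 0) field_differentiable at 0"
    by (rule mixed_partials_commute(1)[OF r hol1 hol2 bd])
  then obtain D where "((\<lambda>s. deriv (?G s) 0) has_field_derivative D) (at 0)"
    by (auto simp: field_differentiable_def)
  then have "((\<lambda>s. dir_deriv f v (s *s u)) has_field_derivative D) (at 0)"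
    using DERIV_cong_ev[OF refl ev1 refl] by blast
  then show "(\<lambda>s. dir_deriv f v (s *s u)) field_differentiable at 0"
    by (auto simp: field_differentiable_def)
  have "deriv (\<lambda>s. deriv (?G s) 0) 0 = deriv (\<lambda>t. deriv (\<lambda>s. ?G s t) 0) 0"
    by (rule mixed_partials_commute(2)[OF r hol1 hol2 bd])
  then show "second_dir_deriv f u v = second_dir_deriv f v u"
    unfolding second_dir_deriv_def
    using deriv_cong_ev[OF ev1 refl] deriv_cong_ev[OF ev2 refl] by simp
qed

lemma eventually_line_in_polydisc:
  "eventually (\<lambda>s. s *s (u :: complex ^ 'n::finite) \<in> polydisc) (nhds 0)"
proof -
  have "s *s u \<in> polydisc" if s: "cmod s < 1 / (norm u + 1)" for s
  proof -
    have "cmod s * (norm u + 1) < 1"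
      using s by (simp add: less_divide_eq add_nonneg_pos)
    moreover have "cmod s * norm u \<le> cmod s * (norm u + 1)" by (intro mult_left_mono) auto
    ultimately have "norm (s *s u) < 1" unfolding norm_vector_scalar_mult by linarith
    then show ?thesis using ball_subset_polydisc by auto
  qed
  then show ?thesis
    unfolding eventually_nhds_metric
    by (intro exI[of _ "1 / (norm u + 1)"]) (simp add: add_nonneg_pos)
qed

lemma second_dir_deriv_expand:
  assumes f: "holomorphic_several f (polydisc :: (complex ^ 'n::finite) set)"
  shows "second_dir_deriv f u \<alpha> = (\<Sum>i\<in>UNIV. \<alpha> $ i * second_dir_deriv f u (axis i 1))"
proof -
  have "eventually (\<lambda>s. dir_deriv f \<alpha> (s *s u) = (\<Sum>i\<in>UNIV. \<alpha> $ i * dir_deriv f (axis i 1) (s *s u))) (nhds 0)"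
    using eventually_line_in_polydisc[of u]
    by eventually_elim (rule dir_deriv_expand[OF f])
  then have "second_dir_deriv f u \<alpha>
      = deriv (\<lambda>s. \<Sum>i\<in>UNIV. \<alpha> $ i * dir_deriv f (axis i 1) (s *s u)) 0"
    unfolding second_dir_deriv_def by (intro deriv_cong_ev refl)
  also have "\<dots> = (\<Sum>i\<in>UNIV. \<alpha> $ i * second_dir_deriv f u (axis i 1))"
    unfolding second_dir_deriv_def
    by (intro DERIV_imp_deriv DERIV_sum DERIV_cmult field_differentiable_derivI
        dir_deriv_differentiable_along_line[OF f])
  finally show ?thesis .
qed

lemma partial_partial_eq:
  assumes f: "holomorphic_several f (polydisc :: (complex ^ 'n::finite) set)"
  shows "partial i (partial j f) 0 = second_dir_deriv f (axis i 1) (axis j 1)"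
proof -
  have "(\<lambda>w. partial j f (\<chi> k. if k = i then w else 0 $ k)) = (\<lambda>w. partial j f (w *s axis i 1))"
    by (intro ext arg_cong[where f = "partial j f"]) (simp add: vec_eq_iff axis_def)
  moreover have "eventually (\<lambda>w. partial j f (w *s axis i 1) = dir_deriv f (axis j 1) (w *s axis i 1)) (nhds 0)"
    using eventually_line_in_polydisc[of "axis i 1"]
    by eventually_elim (rule partial_eq_dir_deriv[OF f])
  ultimately show ?thesis
    unfolding partial_def[of i] second_dir_deriv_def by (simp add: deriv_cong_ev)
qed

lemma D1_eq_dir_deriv:
  assumes f: "holomorphic_several f (polydisc :: (complex ^ 'n::finite) set)"
  shows "D1 f 0 \<alpha> = dir_deriv f \<alpha> 0"
  unfolding D1_def dir_deriv_expand[OF f zero_in_polydisc, of \<alpha>]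
  by (simp add: partial_eq_dir_deriv[OF f zero_in_polydisc] mult.commute)

text \<open>The chain rule of second order along a line: expand by linearity in the second direction,
  exchange the directions, and expand once more.\<close>

lemma D2_outer_eq_second_dir_deriv:
  assumes f: "holomorphic_several f (polydisc :: (complex ^ 'n::finite) set)"
  shows "D2 f 0 (outer \<alpha>) = second_dir_deriv f \<alpha> \<alpha>"
proof -
  have "second_dir_deriv f \<alpha> \<alpha> = (\<Sum>i\<in>UNIV. \<alpha> $ i * second_dir_deriv f (axis i 1) \<alpha>)"
    by (subst second_dir_deriv_expand[OF f]) (simp only: second_dir_deriv_commute[OF f, of \<alpha>])
  also have "\<dots> = (\<Sum>i\<in>UNIV. \<Sum>j\<in>UNIV. second_dir_deriv f (axis i 1) (axis j 1) * (\<alpha> $ i * \<alpha> $ j))"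
    by (subst second_dir_deriv_expand[OF f]) (simp add: sum_distrib_left mult_ac)
  also have "\<dots> = D2 f 0 (outer \<alpha>)"
    by (simp add: D2_def outer_def partial_partial_eq[OF f])
  finally show ?thesis ..
qed

text \<open>The slice of \<open>f\<close> through \<open>\<alpha>\<close> carries the first- and second-order data of \<open>f\<close> at the
  origin into the reach of one-variable function theory.\<close>

lemma
  assumes f: "holomorphic_several f (polydisc :: (complex ^ 'n::finite) set)"
    and \<alpha>: "max_norm \<alpha> \<le> 1"
  shows holomorphic_slice: "(\<lambda>s. f (s *s \<alpha>)) holomorphic_on ball 0 1"
    and deriv_slice: "deriv (\<lambda>s. f (s *s \<alpha>)) 0 = D1 f 0 \<alpha>"
    and deriv_deriv_slice: "deriv (deriv (\<lambda>s. f (s *s \<alpha>))) 0 = D2 f 0 (outer \<alpha>)"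
proof -
  let ?g = "\<lambda>s. f (s *s \<alpha>)"
  have d: "(?g has_field_derivative dir_deriv f \<alpha> (s *s \<alpha>)) (at s)" if "s \<in> ball 0 1" for s
    using has_field_derivative_along_line[OF f, of 0 s \<alpha>] scaled_in_polydisc[OF \<alpha>] that by simp
  show "?g holomorphic_on ball 0 1"
    using d unfolding holomorphic_on_open[OF open_ball] by blast
  show "deriv ?g 0 = D1 f 0 \<alpha>"
    using DERIV_imp_deriv[OF d[of 0]] by (simp add: D1_eq_dir_deriv[OF f])
  have "eventually (\<lambda>s::complex. s \<in> ball 0 1) (nhds 0)"
    by (rule eventually_nhds_in_open) auto
  then have "eventually (\<lambda>s. deriv ?g s = dir_deriv f \<alpha> (s *s \<alpha>)) (nhds 0)"
    by eventually_elim (rule DERIV_imp_deriv[OF d])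
  then have "deriv (deriv ?g) 0 = second_dir_deriv f \<alpha> \<alpha>"
    unfolding second_dir_deriv_def by (intro deriv_cong_ev refl)
  then show "deriv (deriv ?g) 0 = D2 f 0 (outer \<alpha>)"
    by (simp add: D2_outer_eq_second_dir_deriv[OF f])
qed

section \<open>Polynomials are holomorphic\<close>

lemma holomorphic_several_coord: "holomorphic_several (\<lambda>z. z $ i) S"
  unfolding holomorphic_several_def
  by (intro ballI exI[of _ "\<lambda>v. v $ i"] conjI bounded_linear_imp_has_derivative
      bounded_linear_vec_nth) simp

lemma holomorphic_several_const: "holomorphic_several (\<lambda>z. c) S"
  unfolding holomorphic_several_def
  by (intro ballI exI[of _ "\<lambda>v. 0"] conjI has_derivative_const) simp

lemma holomorphic_several_add:
  assumes "holomorphic_several f S" "holomorphic_several g S"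
  shows "holomorphic_several (\<lambda>z. f z + g z) S"
  unfolding holomorphic_several_def
proof
  fix z assume z: "z \<in> S"
  show "\<exists>f'. ((\<lambda>z. f z + g z) has_derivative f') (at z) \<and> (\<forall>c v. f' (c *s v) = c * f' v)"
    by (intro exI conjI, rule has_derivative_add[OF has_derivative_dir_deriv[OF assms(1) z]
          has_derivative_dir_deriv[OF assms(2) z]])
       (simp add: dir_deriv_scale[OF assms(1) z]
          dir_deriv_scale[OF assms(2) z] algebra_simps)
qed

lemma holomorphic_several_mult:
  assumes "holomorphic_several f S" "holomorphic_several g S"
  shows "holomorphic_several (\<lambda>z. f z * g z) S"
  unfolding holomorphic_several_def
proof
  fix z assume z: "z \<in> S"
  show "\<exists>f'. ((\<lambda>z. f z * g z) has_derivative f') (at z) \<and> (\<forall>c v. f' (c *s v) = c * f' v)"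
    by (intro exI conjI, rule has_derivative_mult[OF has_derivative_dir_deriv[OF assms(1) z]
          has_derivative_dir_deriv[OF assms(2) z]])
       (simp add: dir_deriv_scale[OF assms(1) z]
          dir_deriv_scale[OF assms(2) z] algebra_simps)
qed

lemma holomorphic_several_sum:
  "(\<And>i. i \<in> I \<Longrightarrow> holomorphic_several (f i) S) \<Longrightarrow> holomorphic_several (\<lambda>z. \<Sum>i\<in>I. f i z) S"
  by (induction I rule: infinite_finite_induct)
     (simp_all add: holomorphic_several_const holomorphic_several_add)

lemma holomorphic_several_prod:
  "(\<And>i. i \<in> I \<Longrightarrow> holomorphic_several (f i) S) \<Longrightarrow> holomorphic_several (\<lambda>z. \<Prod>i\<in>I. f i z) S"
  by (induction I rule: infinite_finite_induct)
     (simp_all add: holomorphic_several_const holomorphic_several_mult)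

lemma holomorphic_several_power:
  "holomorphic_several f S \<Longrightarrow> holomorphic_several (\<lambda>z. f z ^ n) S"
  by (induction n) (simp_all add: holomorphic_several_const holomorphic_several_mult)

lemma holomorphic_several_poly_eval: "holomorphic_several (poly_eval p) S"
proof -
  have "poly_eval p
      = (\<lambda>z. \<Sum>k\<in>Poly_Mapping.keys p. Poly_Mapping.lookup p k * (\<Prod>i\<in>UNIV. (z $ i) ^ k i))"
    by (simp add: poly_eval_def fun_eq_iff)
  then show ?thesis
    by (simp add: holomorphic_several_sum holomorphic_several_mult holomorphic_several_const
        holomorphic_several_prod holomorphic_several_power holomorphic_several_coord)
qed

section \<open>Derivatives of multi-index order at most two\<close>

lemma coord_list: "distinct (coord_list :: 'n::finite list)" "set (coord_list :: 'n list) = UNIV"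
proof -
  have "\<exists>xs :: 'n list. distinct xs \<and> set xs = UNIV"
    using finite_distinct_list[of "UNIV :: 'n set"] by auto
  then show "distinct (coord_list :: 'n list)" "set (coord_list :: 'n list) = UNIV"
    unfolding coord_list_def by (rule someI2_ex, blast)+
qed

lemma foldr_partial_vanishing_index:
  "(\<And>i. i \<in> set xs \<Longrightarrow> k i = 0) \<Longrightarrow> foldr (\<lambda>i. partial i ^^ k i) xs f = f"
  by (induction xs) simp_all

lemma multi_deriv_zero: "multi_deriv (\<lambda>_. 0) f = f"
  unfolding multi_deriv_def by (rule foldr_partial_vanishing_index) simp

lemma multi_deriv_axis_power:
  "multi_deriv (\<lambda>x. if x = i then m else 0) f = (partial i ^^ m) f"
proof -
  obtain ys zs where s: "coord_list = ys @ i # zs"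
    using coord_list(2) by (metis UNIV_I split_list)
  let ?F = "foldr (\<lambda>x. partial x ^^ (if x = i then m else 0))"
  have "distinct (ys @ i # zs)" unfolding s[symmetric] by (rule coord_list(1))
  then have "?F ys g = g" "?F zs g = g" for g
    by (auto intro!: foldr_partial_vanishing_index)
  then show ?thesis
    unfolding multi_deriv_def s by simp
qed

text \<open>Which of the two orders of differentiation occurs depends on the arbitrary numbering of the
  coordinates, so only membership can be claimed.\<close>

lemma multi_deriv_mixed:
  assumes "i \<noteq> j"
  shows "multi_deriv (\<lambda>x. if x = i \<or> x = j then 1 else 0) f
         \<in> {partial i (partial j f), partial j (partial i f)}"
proof -
  let ?k = "\<lambda>x. if x = i \<or> x = j then 1 else (0::nat)"
  have main: "foldr (\<lambda>x. partial x ^^ ?k x) (as @ a # bs @ b # cs) f = partial a (partial b f)"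
    if "distinct (as @ a # bs @ b # cs)" "{a, b} = {i, j}" for as bs cs a b
  proof -
    have v: "?k x = 0" if "x \<in> set as \<union> set bs \<union> set cs" for x
      using that \<open>distinct _\<close> \<open>{a, b} = {i, j}\<close> by (auto simp: doubleton_eq_iff)
    have "?k a = 1" "?k b = 1" using \<open>{a, b} = {i, j}\<close> by (auto simp: doubleton_eq_iff)
    then show ?thesis
      using v by (simp add: foldr_partial_vanishing_index del: if_split)
  qed
  obtain ys zs where s: "coord_list = ys @ i # zs"
    using coord_list(2) by (metis UNIV_I split_list)
  have "set (ys @ i # zs) = UNIV" unfolding s[symmetric] by (rule coord_list(2))
  then have "j \<in> set (ys @ i # zs)" by (rule ssubst) (rule UNIV_I)
  then have "j \<in> set ys \<or> j \<in> set zs" using assms by auto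
  then show ?thesis
  proof
    assume "j \<in> set ys"
    then obtain as bs where "ys = as @ j # bs" by (meson split_list)
    then have c: "coord_list = as @ j # bs @ i # zs" using s by simp
    have "distinct (as @ j # bs @ i # zs)" unfolding c[symmetric] by (rule coord_list(1))
    from main[OF this] show ?thesis unfolding multi_deriv_def c by blast
  next
    assume "j \<in> set zs"
    then obtain bs cs where "zs = bs @ j # cs" by (meson split_list)
    then have c: "coord_list = ys @ i # bs @ j # cs" using s by simp
    have "distinct (ys @ i # bs @ j # cs)" unfolding c[symmetric] by (rule coord_list(1))
    from main[OF this] show ?thesis unfolding multi_deriv_def c by blast
  qed
qed

text \<open>For each pair of coordinates the multi-index of weight two supplies one of the two mixed
  derivatives, while \<open>D2\<close> contains both; the other one vanishes by symmetry.\<close>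

lemma
  assumes f: "holomorphic_several f (polydisc :: (complex ^ 'n::finite) set)"
    and van: "\<And>k. mi_size k \<le> 2 \<Longrightarrow> multi_deriv k f 0 = 0"
  shows multi_deriv_vanishing_value: "f 0 = 0"
    and multi_deriv_vanishing_D1: "D1 f 0 \<alpha> = 0"
    and multi_deriv_vanishing_D2: "D2 f 0 A = 0"
proof -
  show "f 0 = 0"
    using van[of "\<lambda>_. 0"] by (simp add: mi_size_def multi_deriv_zero)
  have "partial i f 0 = 0" for i
    using van[of "\<lambda>x. if x = i then 1 else 0"] multi_deriv_axis_power[of i 1 f]
    by (simp add: mi_size_def)
  then show "D1 f 0 \<alpha> = 0" by (simp add: D1_def)
  have "partial i (partial j f) 0 = 0" for i j
  proof (cases "i = j")
    case True
    then show ?thesis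
      using van[of "\<lambda>x. if x = i then 2 else 0"] multi_deriv_axis_power[of i 2 f]
      by (simp add: mi_size_def numeral_2_eq_2)
  next
    case False
    let ?k = "\<lambda>x. if x = i \<or> x = j then 1 else (0::nat)"
    have "mi_size ?k = (\<Sum>x\<in>{i, j}. 1)"
      unfolding mi_size_def by (rule sum.mono_neutral_cong_right) auto
    then have "multi_deriv ?k f 0 = 0" using False by (intro van) simp
    moreover have "partial j (partial i f) 0 = partial i (partial j f) 0"
      by (simp only: partial_partial_eq[OF f] second_dir_deriv_commute[OF f])
    ultimately show ?thesis using multi_deriv_mixed[OF False, of f] by auto
  qed
  then show "D2 f 0 A = 0" by (simp add: D2_def)
qed

section \<open>The inequality on the polydisc\<close>

theorem theorem1p13:
  fixes p :: "'n::finite cpoly"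
  assumes "total_degree p = 2"
    and "poly_eval p 0 = 0"
    and "\<exists>q :: complex ^ 'n \<Rightarrow> complex.
           holomorphic_several q polydisc \<and>
           (\<forall>k. mi_size k \<le> 2 \<longrightarrow> multi_deriv k q 0 = 0) \<and>
           sup_norm_on polydisc (\<lambda>z. poly_eval p z + q z) \<le> 1"
  shows "(SUP \<alpha>\<in>{\<alpha> :: complex ^ 'n. max_norm \<alpha> \<le> 1}.
            ereal (cmod (D2 (poly_eval p) 0 (outer \<alpha>) / 2) + (cmod (D1 (poly_eval p) 0 \<alpha>))\<^sup>2)) \<le> 1"
proof (rule SUP_least)
  fix \<alpha> :: "complex ^ 'n"
  assume "\<alpha> \<in> {\<alpha>. max_norm \<alpha> \<le> 1}"
  then have \<alpha>: "max_norm \<alpha> \<le> 1" by simp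
  obtain q :: "complex ^ 'n \<Rightarrow> complex" where q: "holomorphic_several q polydisc"
    and van: "\<And>k. mi_size k \<le> 2 \<Longrightarrow> multi_deriv k q 0 = 0"
    and bound: "sup_norm_on polydisc (\<lambda>z. poly_eval p z + q z) \<le> 1"
    using assms(3) by blast
  note p = holomorphic_several_poly_eval[of p polydisc]
  let ?P = "\<lambda>s. poly_eval p (s *s \<alpha>)" and ?Q = "\<lambda>s. q (s *s \<alpha>)"
  let ?f = "\<lambda>s. ?P s + ?Q s"
  have holP: "?P holomorphic_on ball 0 1" and holQ: "?Q holomorphic_on ball 0 1"
    by (rule holomorphic_slice[OF p \<alpha>], rule holomorphic_slice[OF q \<alpha>])
  have hol: "?f holomorphic_on ball 0 1" by (intro holomorphic_intros holP holQ)
  have zero: "?f 0 = 0"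
    using assms(2) multi_deriv_vanishing_value[OF q van] by simp
  have le1: "cmod (?f s) \<le> 1" if "cmod s < 1" for s
  proof -
    have "ereal (cmod (?f s)) \<le> sup_norm_on polydisc (\<lambda>z. poly_eval p z + q z)"
      unfolding sup_norm_on_def by (rule SUP_upper) (rule scaled_in_polydisc[OF \<alpha> that])
    also note bound
    finally show ?thesis by simp
  qed
  have add: "(deriv ^^ n) ?f 0 = (deriv ^^ n) ?P 0 + (deriv ^^ n) ?Q 0" for n
    by (rule higher_deriv_add[OF holP holQ]) auto
  have d1: "deriv ?f 0 = D1 (poly_eval p) 0 \<alpha>"
    using add[of 1] by (simp add: deriv_slice[OF p \<alpha>] deriv_slice[OF q \<alpha>]
        multi_deriv_vanishing_D1[OF q van])
  have d2: "deriv (deriv ?f) 0 = D2 (poly_eval p) 0 (outer \<alpha>)"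
    using add[of 2] by (simp add: numeral_2_eq_2 deriv_deriv_slice[OF p \<alpha>]
        deriv_deriv_slice[OF q \<alpha>] multi_deriv_vanishing_D2[OF q van])
  show "ereal (cmod (D2 (poly_eval p) 0 (outer \<alpha>) / 2) + (cmod (D1 (poly_eval p) 0 \<alpha>))\<^sup>2) \<le> 1"
    using schwarz_second_coefficient[OF hol zero le1] unfolding d1 d2 by simp
qed

end
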